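(* Let $k$ be a positive integer and $n$ a nonnegative integer. The mapping $\pi$ restricts to a bijection from $\mathcal{P}^{(k)}_{n,kn}(D,EENN)$ to $\mathcal{P}^{(k)}_{n,kn}(NE,EN)$, and the mapping $\delta$ restricts to a bijection from $\mathcal{P}^{(k)}_{n,kn}(NE,EN)$ to $\mathcal{P}^{(k)}_{n,kn}(D,EENN)$; thus $$\#\mathcal{P}^{(k)}_{n,kn}(D,EENN)=\#\mathcal{P}^{(k)}_{n,kn}(NE,EN).$$
   Context: A lattice path is a finite sequence $(v_1,\dots,v_r)$ of points of $\mathbb{Z}^2$; its steps are the differences $v_{i+1}-v_i$, and the path is identified with its starting point together with the word of its steps. Write $N=(0,1)$, $E=(1,0)$, $D=(1,1)$. A path is Delannoy if every step belongs to $\{N,E,D\}$. $\mathcal{P}_{n,m}$ is the set of Delannoy paths from the origin $(0,0)$ to $(n,m)$, and $\mathcal{P}^{(k)}_{n,m}$ is the subset of those paths all of whose vertices lie in $\{(x,y)\in\mathbb{Z}^2: y\ge kx\}$. A path contains a pattern (a word in $N,E,D$) if this word occurs as a block of consecutive steps; $\mathcal{P}_{n,m}(\omega_1,\dots,\omega_s)$ and $\mathcal{P}^{(k)}_{n,m}(\omega_1,\dots,\omega_s)$ denote the sets of paths in $\mathcal{P}_{n,m}$, respectively $\mathcal{P}^{(k)}_{n,m}$, containing none of the patterns $\omega_1,\dots,\omega_s$. The mapping $\pi:\mathcal{P}_{n,m}(D)\to\mathcal{P}_{n,m}(NE)$ replaces each consecutive $NE$ (peak) of a path by a diagonal step $D$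 (all peaks replaced simultaneously). The mapping $\delta:\mathcal{P}_{n,m}(NE)\to\mathcal{P}_{n,m}(D)$ replaces each diagonal step $D$ of a path by the two steps $NE$. *)

theory Defs
  imports Main "HOL-Library.Product_Plus" "HOL-Library.Sublist"
begin

type_synonym point = "int \<times> int"

definition north :: point where "north = (0, 1)"
definition east :: point where "east = (1, 0)"
definition diag :: point where "diag = (1, 1)"

text \<open>
  A lattice path is identified with its starting point and the word of its steps. All path sets
  below start at the origin, so their elements are just words of steps.
\<close>

fun vertices :: "point \<Rightarrow> point list \<Rightarrow> point list" where
  "vertices p [] = [p]"
| "vertices p (s # w) = p # vertices (p + s) w"

definition delannoy_paths :: "nat \<Rightarrow> nat \<Rightarrow> point list set" where
  "delannoy_paths n m =
     {w. set w \<subseteq> {north, east, diag} \<and> last (vertices (0, 0) w) = (int n, int m)}"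

definition delannoy_paths_above :: "nat \<Rightarrow> nat \<Rightarrow> nat \<Rightarrow> point list set" where
  "delannoy_paths_above k n m =
     {w \<in> delannoy_paths n m. \<forall>(x, y) \<in> set (vertices (0, 0) w). y \<ge> int k * x}"

text \<open>Containing a pattern means having it as a block of consecutive steps, i.e.\ as a
  contiguous \<^const>\<open>sublist\<close>.\<close>

definition avoiding :: "point list set \<Rightarrow> point list set \<Rightarrow> point list set" where
  "avoiding P \<Omega> = {w \<in> P. \<forall>\<omega> \<in> \<Omega>. \<not> sublist \<omega> w}"

text \<open>
  The map \<open>\<pi>\<close>. Two occurrences of the block \<open>NE\<close> never overlap, so the left-to-right scan
  replaces all peaks of the given path simultaneously.
\<close>

fun peaks_to_diags :: "point list \<Rightarrow> point list" where
  "peaks_to_diags [] = []"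
| "peaks_to_diags [s] = [s]"
| "peaks_to_diags (s # t # w) =
     (if s = north \<and> t = east then diag # peaks_to_diags w else s # peaks_to_diags (t # w))"

text \<open>The map \<open>\<delta>\<close>.\<close>

definition diags_to_peaks :: "point list \<Rightarrow> point list" where
  "diags_to_peaks w = concat (map (\<lambda>s. if s = diag then [north, east] else [s]) w)"

end

theory Submission
  imports Defs
begin

text \<open>
  The maps \<open>\<pi>\<close> and \<open>\<delta>\<close> are mutually inverse between words without \<open>D\<close> and words without \<open>NE\<close>,
  so it suffices to see that \<open>\<delta>\<close> matches the remaining conditions. A block \<open>EENN\<close> in \<open>\<delta>(v)\<close>
  has its middle \<open>EN\<close> already in \<open>v\<close>. Conversely, a block \<open>EN\<close> in \<open>v\<close> is neither initial nor
  final, since otherwise the path would go below \<open>y = kx\<close>; as \<open>v\<close> avoids \<open>NE\<close>, the block is preceded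
  by \<open>E\<close> or \<open>D\<close> and followed by \<open>N\<close> or \<open>D\<close>, which produces \<open>EENN\<close> in \<open>\<delta>(v)\<close>. The region
  \<open>y \<ge> kx\<close> is respected since \<open>\<delta>\<close> only adds vertices lying directly above old ones.
\<close>

lemma step_distinct [simp]:
  "north \<noteq> east" "east \<noteq> north" "north \<noteq> diag" "diag \<noteq> north" "east \<noteq> diag" "diag \<noteq> east"
  by (auto simp: north_def east_def diag_def)

lemma diag_eq: "diag = north + east"
  by (simp add: north_def east_def diag_def)

lemma diags_to_peaks_simps [simp]:
  "diags_to_peaks [] = []"
  "diags_to_peaks (s # w) = (if s = diag then north # east # diags_to_peaks w else s # diags_to_peaks w)"
  "diags_to_peaks (u @ w) = diags_to_peaks u @ diags_to_peaks w"
  by (simp_all add: diags_to_peaks_def)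

lemma diags_to_peaks_peaks_to_diags:
  "diag \<notin> set w \<Longrightarrow> diags_to_peaks (peaks_to_diags w) = w"
  by (induction w rule: peaks_to_diags.induct) auto

text \<open>An expanded \<open>diag\<close> starts with \<open>north\<close>, so a
  \<open>north\<close> of \<open>v\<close> itself is followed by \<open>east\<close> after expansion
  only if \<open>v\<close> had that peak already. The scan thus merges exactly the inserted
  pairs.\<close>

lemma peaks_to_diags_diags_to_peaks:
  "\<not> sublist [north, east] v \<Longrightarrow> peaks_to_diags (diags_to_peaks v) = v"
proof (induction v)
  case Nil
  then show ?case by simp
next
  case (Cons s v)
  have "\<not> sublist [north, east] v"
    using Cons.prems by (simp add: sublist_Cons_right)
  then have "peaks_to_diags (diags_to_peaks v) = v"
    by (rule Cons.IH)
  then show ?case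
    using Cons.prems by (cases v) (auto simp: sublist_Cons_right)
qed

lemma peaks_to_diags_Cons_eq_east:
  "peaks_to_diags (t # w) = east # u \<Longrightarrow> t = east"
  by (cases w) (auto split: if_splits)

text \<open>A leading \<open>east\<close> of the output was already leading in the input, so a kept
  \<open>north\<close> right before it would have been merged with it by the scan.\<close>

lemma peaks_to_diags_no_peak: "\<not> sublist [north, east] (peaks_to_diags w)"
proof (induction w rule: peaks_to_diags.induct)
  case (3 s t w)
  then show ?case
    by (auto simp: sublist_Cons_right prefix_def dest: peaks_to_diags_Cons_eq_east)
qed (auto simp: sublist_Cons_right)

lemma set_peaks_to_diags: "set (peaks_to_diags w) \<subseteq> insert diag (set w)"
  by (induction w rule: peaks_to_diags.induct) auto

lemma set_diags_to_peaks: "set (diags_to_peaks v) \<subseteq> {north, east} \<union> (set v - {diag})"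
  by (induction v) auto

lemma vertices_neq_Nil [simp]: "vertices p w \<noteq> []"
  by (cases w) auto

lemma start_in_vertices [simp]: "p \<in> set (vertices p w)"
  by (cases w) auto

lemma vertices_snoc: "vertices p (w @ [s]) = vertices p w @ [last (vertices p w) + s]"
  by (induction w arbitrary: p) auto

lemma last_vertices_diags_to_peaks:
  "last (vertices p (diags_to_peaks v)) = last (vertices p v)"
  by (induction v arbitrary: p) (auto simp: diag_eq add.assoc)

lemma vertices_subset_diags_to_peaks:
  "set (vertices p v) \<subseteq> set (vertices p (diags_to_peaks v))"
proof (induction v arbitrary: p)
  case (Cons s v)
  show ?case
    using Cons.IH[of "p + s"] by (auto simp: diag_eq add.assoc)
qed simp

text \<open>The only new vertices are the midpoints of expanded diagonals, one unit above their
  starting points.\<close>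

lemma vertices_diags_to_peaks_subset:
  "set (vertices p (diags_to_peaks v)) \<subseteq> set (vertices p v) \<union> (\<lambda>q. q + north) ` set (vertices p v)"
proof (induction v arbitrary: p)
  case (Cons s v)
  show ?case
    using Cons.IH[of "p + s"] by (auto simp: diag_eq add.assoc)
qed auto

text \<open>An equivalence, so that it serves \<delta> from right to left and, for
  \<open>v = peaks_to_diags w\<close>, also \<pi> from left to right.\<close>

lemma delannoy_paths_above_diags_to_peaks:
  assumes "set v \<subseteq> {north, east, diag}"
  shows "diags_to_peaks v \<in> delannoy_paths_above k n m \<longleftrightarrow> v \<in> delannoy_paths_above k n m"
proof -
  let ?V = "set (vertices (0, 0) v)" and ?W = "set (vertices (0, 0) (diags_to_peaks v))"
  have "(\<forall>(x, y) \<in> ?W. int k * x \<le> y) \<longleftrightarrow> (\<forall>(x, y) \<in> ?V. int k * x \<le> y)"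
  proof
    assume "\<forall>(x, y) \<in> ?W. int k * x \<le> y"
    then show "\<forall>(x, y) \<in> ?V. int k * x \<le> y"
      using vertices_subset_diags_to_peaks by blast
  next
    assume V: "\<forall>(x, y) \<in> ?V. int k * x \<le> y"
    then have "\<forall>(x, y) \<in> (\<lambda>q. q + north) ` ?V. int k * x \<le> y"
      by (fastforce simp: north_def)
    with V show "\<forall>(x, y) \<in> ?W. int k * x \<le> y"
      using vertices_diags_to_peaks_subset[of "(0, 0)" v] by blast
  qed
  moreover have "set (diags_to_peaks v) \<subseteq> {north, east, diag}"
    using set_diags_to_peaks[of v] assms by blast
  ultimately show ?thesis
    using assms
    by (simp add: delannoy_paths_above_def delannoy_paths_def last_vertices_diags_to_peaks)
qed

text \<open>The initial \<open>east\<close> cannot come from a \<open>diag\<close>, whose expansion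
  starts with \<open>north\<close>; nor can the first \<open>north\<close>, which would then be
  followed by \<open>east\<close>.\<close>

lemma prefix_ENN_diags_to_peaks:
  assumes "prefix [east, north, north] (diags_to_peaks v)"
  shows "prefix [east, north] v"
proof -
  obtain v' where v: "v = east # v'" and "prefix [north, north] (diags_to_peaks v')"
    using assms by (cases v) (auto split: if_splits)
  then have "prefix [north] v'"
    by (cases v') (auto split: if_splits)
  with v show ?thesis
    by simp
qed

lemma sublist_EENN_diags_to_peaks:
  "sublist [east, east, north, north] (diags_to_peaks v) \<Longrightarrow> sublist [east, north] v"
proof (induction v)
  case (Cons s v)
  \<comment> \<open>A block starting inside the expansion of \<open>s\<close> starts at its last
    letter, so its other three letters begin \<open>diags_to_peaks v\<close>.\<close>
  then consider "prefix [east, north, north] (diags_to_peaks v)"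
    | "sublist [east, east, north, north] (diags_to_peaks v)"
    by (auto simp: sublist_Cons_right split: if_splits)
  then show ?case
    using Cons.IH prefix_ENN_diags_to_peaks[of v] prefix_imp_sublist sublist_Cons_right
    by metis
qed simp

lemma EENN_diags_to_peaks_if_EN:
  assumes "k \<ge> 1" and v: "v \<in> delannoy_paths_above k n (k * n)"
    and NE: "\<not> sublist [north, east] v" and EN: "sublist [east, north] v"
  shows "sublist [east, east, north, north] (diags_to_peaks v)"
proof -
  obtain a b where v_eq: "v = a @ [east, north] @ b"
    using EN by (auto simp: sublist_def)
  have steps: "set v \<subseteq> {north, east, diag}"
    and end_v: "last (vertices (0, 0) v) = (int n, int (k * n))"
    and above: "\<And>x y. (x, y) \<in> set (vertices (0, 0) v) \<Longrightarrow> int k * x \<le> y"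
    using v by (auto simp: delannoy_paths_above_def delannoy_paths_def)
  \<comment> \<open>Here \<open>k \<ge> 1\<close> matters: an initial \<open>east\<close> leads to
    \<open>(1, 0)\<close>, where \<open>y = 0 < k\<close>.\<close>
  have "a \<noteq> []"
  proof
    assume "a = []"
    then have "(1, 0) \<in> set (vertices (0, 0) v)"
      by (simp add: v_eq east_def)
    then show False
      using above \<open>k \<ge> 1\<close> by fastforce
  qed
  then obtain a' s where a: "a = a' @ [s]"
    by (cases a rule: rev_cases) auto
  \<comment> \<open>The endpoint lies on the line \<open>y = k * x\<close>, so a final
    \<open>north\<close> would start one unit below it.\<close>
  have "b \<noteq> []"
  proof
    assume "b = []"
    then have snoc: "v = (a @ [east]) @ [north]"
      by (simp add: v_eq)
    define q where "q = last (vertices (0, 0) (a @ [east]))"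
    have "q \<in> set (vertices (0, 0) v)"
      unfolding snoc vertices_snoc[of _ "a @ [east]"] q_def by simp
    moreover have "q + north = (int n, int (k * n))"
      using end_v unfolding snoc vertices_snoc[of _ "a @ [east]"] q_def by simp
    then have "q = (int n, int (k * n) - 1)"
      by (cases q) (auto simp: north_def)
    ultimately show False
      using above[of "int n" "int (k * n) - 1"] by simp
  qed
  then obtain t b' where b: "b = t # b'"
    by (cases b) auto
  have "s \<noteq> north"
    using NE by (auto simp: sublist_def v_eq a)
  moreover have "t \<noteq> east"
  proof
    assume "t = east"
    then have "v = (a @ [east]) @ [north, east] @ b'"
      by (simp add: v_eq b)
    then show False
      using NE unfolding sublist_def by blast
  qed
  moreover have "s \<in> {north, east, diag}" "t \<in> {north, east, diag}"
    using steps by (auto simp: v_eq a b)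
  \<comment> \<open>Only \<open>east\<close> or \<open>diag\<close> remains for \<open>s\<close>,
    and \<open>north\<close> or \<open>diag\<close> for \<open>t\<close>; \<open>c\<close> and
    \<open>d\<close> hold the other half of an expanded \<open>diag\<close> and are empty
    otherwise.\<close>
  ultimately obtain c d where cd:
    "diags_to_peaks [s] = c @ [east]" "diags_to_peaks [t] = north # d"
    by auto
  have "diags_to_peaks v = diags_to_peaks a' @ diags_to_peaks [s] @ [east, north] @
      diags_to_peaks [t] @ diags_to_peaks b'"
    by (simp add: v_eq a b)
  also have "\<dots> = (diags_to_peaks a' @ c) @ [east, east, north, north] @ (d @ diags_to_peaks b')"
    unfolding cd by simp
  finally show ?thesis
    unfolding sublist_def by blast
qed

lemma sublist_singleton_iff: "sublist [x] w \<longleftrightarrow> x \<in> set w"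
  by (auto simp: sublist_def in_set_conv_decomp)

theorem mainTheorem2:
  fixes k n :: nat
  assumes "k \<ge> 1"
  shows "bij_betw peaks_to_diags
           (avoiding (delannoy_paths_above k n (k * n)) {[diag], [east, east, north, north]})
           (avoiding (delannoy_paths_above k n (k * n)) {[north, east], [east, north]})
       \<and> bij_betw diags_to_peaks
           (avoiding (delannoy_paths_above k n (k * n)) {[north, east], [east, north]})
           (avoiding (delannoy_paths_above k n (k * n)) {[diag], [east, east, north, north]})
       \<and> card (avoiding (delannoy_paths_above k n (k * n)) {[diag], [east, east, north, north]})
         = card (avoiding (delannoy_paths_above k n (k * n)) {[north, east], [east, north]})"
proof -
  let ?P = "delannoy_paths_above k n (k * n)"
  let ?A = "avoiding ?P {[diag], [east, east, north, north]}"
  let ?B = "avoiding ?P {[north, east], [east, north]}"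
  have steps: "set w \<subseteq> {north, east, diag}" if "w \<in> ?P" for w
    using that by (simp add: delannoy_paths_above_def delannoy_paths_def)
  have \<delta>: "diags_to_peaks v \<in> ?A" if "v \<in> ?B" for v
  proof -
    have v: "v \<in> ?P" "\<not> sublist [east, north] v"
      using that by (auto simp: avoiding_def)
    have "diags_to_peaks v \<in> ?P"
      using delannoy_paths_above_diags_to_peaks steps v(1) by blast
    moreover have "diag \<notin> set (diags_to_peaks v)"
      using set_diags_to_peaks[of v] by auto
    ultimately show ?thesis
      using v(2) sublist_EENN_diags_to_peaks by (auto simp: avoiding_def sublist_singleton_iff)
  qed
  have inv: "diags_to_peaks (peaks_to_diags w) = w" if "w \<in> ?A" for w
    using that by (simp add: avoiding_def sublist_singleton_iff diags_to_peaks_peaks_to_diags)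
  have \<pi>: "peaks_to_diags w \<in> ?B" if "w \<in> ?A" for w
  proof -
    have w: "w \<in> ?P" "\<not> sublist [east, east, north, north] w"
      using that by (auto simp: avoiding_def)
    have "set (peaks_to_diags w) \<subseteq> {north, east, diag}"
      using set_peaks_to_diags[of w] steps[OF w(1)] by blast
    then have "peaks_to_diags w \<in> ?P"
      using delannoy_paths_above_diags_to_peaks inv[OF that] w(1) by metis
    moreover from this have "\<not> sublist [east, north] (peaks_to_diags w)"
      using EENN_diags_to_peaks_if_EN[OF assms] peaks_to_diags_no_peak inv[OF that] w(2) by metis
    ultimately show ?thesis
      by (simp add: avoiding_def peaks_to_diags_no_peak)
  qed
  have inv': "peaks_to_diags (diags_to_peaks v) = v" if "v \<in> ?B" for v
    using that by (simp add: avoiding_def peaks_to_diags_diags_to_peaks)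
  have "bij_betw peaks_to_diags ?A ?B"
    using \<delta> \<pi> inv inv' by (intro bij_betw_byWitness[where f' = diags_to_peaks]) auto
  moreover have "bij_betw diags_to_peaks ?B ?A"
    using \<delta> \<pi> inv inv' by (intro bij_betw_byWitness[where f' = peaks_to_diags]) auto
  ultimately show ?thesis
    using bij_betw_same_card by blast
qed

end
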